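(* Let $\mathcal{F}$ be a continuous-time, uncertain, piecewise linear dynamical system on $\mathbb{R}^d$ with modes $Q$, regions $(H_q)_{q\in Q}$ and matrices $(A_q)_{q\in Q}$. Let $\epsilon\ge1$, $\theta>0$, $\delta>0$ and $\bar r=\min\{\frac1\epsilon,\frac{\theta\delta}{2+\theta a_{\max}}\}$. Then the learning algorithm described in the context terminates in at most $|Q|\,\mathrm{Pack}(\bar r;\mathbb{S})$ steps.
   Context: $\|\cdot\|$ is a vector norm on $\mathbb{R}^d$, with unit sphere $\mathbb{S}=\{x:\|x\|=1\}$, dual norm $\|c\|_*=\max\{c^\top x:x\in\mathbb{S}\}$ and induced matrix norm $\|A\|=\max\{\|Ax\|:x\in\mathbb{S}\}$. A continuous-time, uncertain, piecewise linear dynamical system is given by a finite set of modes $Q$ and, for each $q\in Q$, a closed polyhedral conic region $H_q\subseteq\mathbb{R}^d$ and a matrix $A_q\in\mathbb{R}^{d\times d}$. It is identified with the set-valued map $\mathcal{F}(x)=\{A_qx: q\in Q,\ x\in H_q\}$, and $a_{\max}=\max_{q\in Q}\|A_q\|$. A polyhedral function is $V(x)=\max_{c\in\mathcal{V}}c^\top x$ with $\mathcal{V}\subseteq\mathbb{R}^d$ finite and fixed together with $V$; $\mathcal{V}(x)=\{c\in\mathcal{V}:c^\top x=V(x)\}$. Learner problem for a finite set $X$: find a polyhedral function $V$ with set $\mathcal{V}=\{c_x:x\in X\}\subseteq\{c:\|c\|_*\le1\}$ such that for all $x\in X$: $c_x^\top x\ge\frac1\epsilon\|x\|$, and for all $v\in\mathcal{F}(x)$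 and $c\in\mathcal{V}$, $c^\top v\le\frac1\theta(c_x^\top x-c^\top x)-\delta\|x\|$. Verifier problem for $V$: find $x\in\mathbb{R}^d\setminus\{0\}$ (a counterexample) such that either $V(x)\le0$, or there are $v\in\mathcal{F}(x)$ and $c\in\mathcal{V}(x)$ with $c^\top v\ge0$. Learning algorithm: start with $X_0=\emptyset$. For $k=0,1,\ldots$: compute a solution $V_k$ of the learner problem for $X_k$ (if none exists, stop and output FAIL); compute a solution $x_k$ of the verifier problem for $V_k$ (if none exists, stop and output $V_k$); set $\bar x_k=x_k/\|x_k\|$ and $X_{k+1}=X_k\cup\{\bar x_k\}$. For $s>0$ and compact $C\subseteq\mathbb{R}^d$, $\mathrm{Pack}(s;C)$ is the largest cardinality of a subset $\hat C\subseteq C$ such that $\|x-y\|\ge s$ for all distinct $x,y\in\hat C$.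
   Formalization: The formal theorem additionally assumes that the regions H_q cover all of R^d (so F has nonempty values and Q is nonempty); without this the bound fails, e.g. for one mode with A_q = 0 on a single ray in the Euclidean plane. *)

theory Defs
  imports "HOL-Analysis.Analysis"
begin

section \<open>Norms\<close>

text \<open>The norm on \<open>\<real>\<^sup>d\<close> is arbitrary, so it is a parameter \<open>N\<close> and not the (Euclidean) class
  operation \<^const>\<open>norm\<close>. The suprema below are attained, since unit spheres are compact.\<close>

definition vector_norm :: "(real ^ 'd \<Rightarrow> real) \<Rightarrow> bool" where
  "vector_norm N \<longleftrightarrow>
     (\<forall>x. 0 \<le> N x) \<and>
     (\<forall>x. N x = 0 \<longleftrightarrow> x = 0) \<and>
     (\<forall>a x. N (a *\<^sub>R x) = \<bar>a\<bar> * N x) \<and>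
     (\<forall>x y. N (x + y) \<le> N x + N y)"

definition unit_sphere :: "(real ^ 'd \<Rightarrow> real) \<Rightarrow> (real ^ 'd) set" where
  "unit_sphere N = {x. N x = 1}"

definition dual_norm :: "(real ^ 'd \<Rightarrow> real) \<Rightarrow> real ^ 'd \<Rightarrow> real" where
  "dual_norm N c = (SUP x \<in> unit_sphere N. c \<bullet> x)"

definition matrix_norm :: "(real ^ 'd \<Rightarrow> real) \<Rightarrow> real ^ 'd ^ 'd \<Rightarrow> real" where
  "matrix_norm N A = (SUP x \<in> unit_sphere N. N (A *v x))"

text \<open>Every separated subset of a compact set is finite, so \<^prop>\<open>finite P\<close> only excludes the junk
  value of \<^const>\<open>card\<close> on infinite sets; for \<open>s > 0\<close> and compact \<open>C\<close> the maximum exists.\<close>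

definition pack :: "(real ^ 'd \<Rightarrow> real) \<Rightarrow> real \<Rightarrow> (real ^ 'd) set \<Rightarrow> nat" where
  "pack N s C =
     Max {card P | P. P \<subseteq> C \<and> finite P \<and> (\<forall>x\<in>P. \<forall>y\<in>P. x \<noteq> y \<longrightarrow> s \<le> N (x - y))}"


section \<open>Piecewise linear systems\<close>

text \<open>The regions may overlap (the system is uncertain). That they cover the space expresses that
  the system is one on all of \<open>\<real>\<^sup>d\<close>: its set-valued map has nonempty values. Closedness of the
  regions is implied by \<^const>\<open>polyhedron\<close>.\<close>

definition pwl_system :: "'q set \<Rightarrow> ('q \<Rightarrow> (real ^ 'd) set) \<Rightarrow> bool" where
  "pwl_system Q H \<longleftrightarrow>
     finite Q \<and> (\<forall>q\<in>Q. polyhedron (H q) \<and> conic (H q)) \<and> (\<Union>q\<in>Q. H q) = UNIV"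

definition pwl_map ::
  "'q set \<Rightarrow> ('q \<Rightarrow> (real ^ 'd) set) \<Rightarrow> ('q \<Rightarrow> real ^ 'd ^ 'd) \<Rightarrow> real ^ 'd \<Rightarrow> (real ^ 'd) set" where
  "pwl_map Q H A x = {A q *v x | q. q \<in> Q \<and> x \<in> H q}"

definition a_max :: "(real ^ 'd \<Rightarrow> real) \<Rightarrow> 'q set \<Rightarrow> ('q \<Rightarrow> real ^ 'd ^ 'd) \<Rightarrow> real" where
  "a_max N Q A = Max ((\<lambda>q. matrix_norm N (A q)) ` Q)"


section \<open>Polyhedral functions, learner and verifier\<close>

text \<open>A polyhedral function is given by its finite set \<open>\<V>\<close> of linear pieces. The first learner
  problem (\<open>X = {}\<close>) forces \<open>\<V> = {}\<close>; extended reals give that function the value \<open>-\<infinity>\<close>.\<close>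

definition poly_fun :: "(real ^ 'd) set \<Rightarrow> real ^ 'd \<Rightarrow> ereal" where
  "poly_fun \<V> x = (SUP c \<in> \<V>. ereal (c \<bullet> x))"

definition active_pieces :: "(real ^ 'd) set \<Rightarrow> real ^ 'd \<Rightarrow> (real ^ 'd) set" where
  "active_pieces \<V> x = {c \<in> \<V>. ereal (c \<bullet> x) = poly_fun \<V> x}"

definition learner_solution ::
  "(real ^ 'd \<Rightarrow> real) \<Rightarrow> (real ^ 'd \<Rightarrow> (real ^ 'd) set) \<Rightarrow> real \<Rightarrow> real \<Rightarrow> real \<Rightarrow>
   (real ^ 'd) set \<Rightarrow> (real ^ 'd) set \<Rightarrow> bool" where
  "learner_solution N F \<epsilon> \<theta> \<delta> X \<V> \<longleftrightarrow>
     (\<exists>c :: real ^ 'd \<Rightarrow> real ^ 'd.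
        \<V> = c ` X \<and> \<V> \<subseteq> {b. dual_norm N b \<le> 1} \<and>
        (\<forall>x\<in>X. 1 / \<epsilon> * N x \<le> c x \<bullet> x \<and>
           (\<forall>v\<in>F x. \<forall>b\<in>\<V>. b \<bullet> v \<le> 1 / \<theta> * (c x \<bullet> x - b \<bullet> x) - \<delta> * N x)))"

definition verifier_solution ::
  "(real ^ 'd \<Rightarrow> (real ^ 'd) set) \<Rightarrow> (real ^ 'd) set \<Rightarrow> real ^ 'd \<Rightarrow> bool" where
  "verifier_solution F \<V> x \<longleftrightarrow>
     x \<noteq> 0 \<and> (poly_fun \<V> x \<le> 0 \<or> (\<exists>v\<in>F x. \<exists>c\<in>active_pieces \<V> x. 0 \<le> c \<bullet> v))"


section \<open>The learning algorithm\<close>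

datatype 'v alg_state = Running "'v set" | Fail | Output "'v set"

text \<open>\<open>iteration N F \<epsilon> \<theta> \<delta> X s\<close>: one pass through the loop from the sample set \<open>X\<close> can result in
  \<open>s\<close>. It is a relation because the choice of learner and verifier solutions is arbitrary.\<close>

inductive iteration ::
  "(real ^ 'd \<Rightarrow> real) \<Rightarrow> (real ^ 'd \<Rightarrow> (real ^ 'd) set) \<Rightarrow> real \<Rightarrow> real \<Rightarrow> real \<Rightarrow>
   (real ^ 'd) set \<Rightarrow> (real ^ 'd) alg_state \<Rightarrow> bool"
  for N F \<epsilon> \<theta> \<delta> X where
  no_learner_solution: "iteration N F \<epsilon> \<theta> \<delta> X Fail"
    if "\<nexists>\<V>. learner_solution N F \<epsilon> \<theta> \<delta> X \<V>"
| no_counterexample: "iteration N F \<epsilon> \<theta> \<delta> X (Output \<V>)"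
    if "learner_solution N F \<epsilon> \<theta> \<delta> X \<V>" and "\<nexists>x. verifier_solution F \<V> x"
| counterexample: "iteration N F \<epsilon> \<theta> \<delta> X (Running (X \<union> {x /\<^sub>R N x}))"
    if "learner_solution N F \<epsilon> \<theta> \<delta> X \<V>" and "verifier_solution F \<V> x"

definition execution ::
  "(real ^ 'd \<Rightarrow> real) \<Rightarrow> (real ^ 'd \<Rightarrow> (real ^ 'd) set) \<Rightarrow> real \<Rightarrow> real \<Rightarrow> real \<Rightarrow>
   (nat \<Rightarrow> (real ^ 'd) alg_state) \<Rightarrow> bool" where
  "execution N F \<epsilon> \<theta> \<delta> s \<longleftrightarrow>
     s 0 = Running {} \<and>
     (\<forall>k. case s k of Running X \<Rightarrow> iteration N F \<epsilon> \<theta> \<delta> X (s (Suc k)) | _ \<Rightarrow> s (Suc k) = s k)"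

text \<open>Iterations are numbered from \<open>0\<close>, and a step is an iteration that extends the sample set.
  So the algorithm terminates in at most \<open>n\<close> steps iff, whatever choices are made, it stops in some
  iteration \<open>k \<le> n\<close>, i.e. after \<open>k\<close> steps.\<close>

definition terminates_in_at_most ::
  "nat \<Rightarrow> (real ^ 'd \<Rightarrow> real) \<Rightarrow> (real ^ 'd \<Rightarrow> (real ^ 'd) set) \<Rightarrow> real \<Rightarrow> real \<Rightarrow> real \<Rightarrow> bool" where
  "terminates_in_at_most n N F \<epsilon> \<theta> \<delta> \<longleftrightarrow>
     (\<forall>s. execution N F \<epsilon> \<theta> \<delta> s \<longrightarrow>
        (\<exists>k\<le>n. s (Suc k) = Fail \<or> (\<exists>\<V>. s (Suc k) = Output \<V>)))"

end

theory Submission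
  imports Defs
begin

text \<open>Attach to every counterexample a mode: the one whose dynamics violates the decrease condition,
  or any mode active at the point if instead the candidate function is nonpositive there. The
  learner's conditions at an earlier sample \<open>x\<close> hold with a margin, namely \<open>1 / \<epsilon>\<close> for positivity
  and \<open>\<delta>\<close> for decrease along \<^emph>\<open>every\<close> mode active at \<open>x\<close>. Since all pieces have dual norm at most
  \<open>1\<close>, the quantities involved are Lipschitz in the point, so a violation at a unit vector
  \<open>y\<close> through a mode that is also active at \<open>x\<close> forces the distance of \<open>x\<close> and \<open>y\<close> to be at least
  the radius \<open>r\<close> of the theorem (lemma \<open>counterexample_far_from_samples\<close>).

  Hence the samples that carry the same mode are \<open>r\<close>-separated points of the unit sphere, and there
  are at most \<open>pack\<close> many of them for each mode. As the new point is also different from all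
  samples, each step enlarges the sample set (lemma \<open>running_invariant\<close>), so the number of steps
  is the number of samples, at most \<open>card Q\<close> times the packing number.\<close>

section \<open>Arbitrary norms on Euclidean space\<close>

lemma vector_normD:
  assumes "vector_norm N"
  shows "0 \<le> N x" and "N x = 0 \<longleftrightarrow> x = 0" and "N (a *\<^sub>R x) = \<bar>a\<bar> * N x"
    and "N (x + y) \<le> N x + N y" and "N 0 = 0"
  using assms unfolding vector_norm_def by blast+

lemma vector_norm_minus_commute:
  assumes "vector_norm N"
  shows "N (x - y) = N (y - x)"
  using vector_normD(3)[OF assms, of "-1" "y - x"] by simp

lemma vector_norm_normalize:
  assumes "vector_norm N" and "x \<noteq> 0"
  shows "N (x /\<^sub>R N x) = 1"
  using vector_normD(1,2)[OF assms(1), of x] assms(2)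
  by (simp add: vector_normD(3)[OF assms(1)])

lemma vector_norm_sum_le:
  assumes "vector_norm N"
  shows "N (\<Sum>i\<in>I. f i) \<le> (\<Sum>i\<in>I. N (f i))"
proof (induction I rule: infinite_finite_induct)
  case (insert i I)
  then show ?case
    using vector_normD(4)[OF assms, of "f i" "\<Sum>i\<in>I. f i"] by simp
qed (simp_all add: vector_normD(5)[OF assms])

lemma vector_norm_le_norm:
  fixes N :: "real ^ 'd \<Rightarrow> real"
  assumes "vector_norm N"
  obtains C where "C > 0" and "\<And>x. N x \<le> C * norm x"
proof
  let ?C = "1 + (\<Sum>i\<in>UNIV. N (axis i 1))"
  have sum_nonneg: "0 \<le> (\<Sum>i\<in>UNIV. N (axis i 1))"
    by (simp add: sum_nonneg vector_normD(1)[OF assms])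
  then show "?C > 0"
    by simp
  fix x
  have "N x = N (\<Sum>i\<in>UNIV. (x $ i) *\<^sub>R axis i 1)"
    by (simp add: basis_expansion flip: scalar_mult_eq_scaleR)
  also have "\<dots> \<le> (\<Sum>i\<in>UNIV. N ((x $ i) *\<^sub>R axis i 1))"
    by (rule vector_norm_sum_le[OF assms])
  also have "\<dots> \<le> (\<Sum>i\<in>UNIV. norm x * N (axis i 1))"
    by (intro sum_mono)
      (simp add: vector_normD(1,3)[OF assms] mult_right_mono component_le_norm_cart)
  also have "\<dots> \<le> ?C * norm x"
    by (simp add: sum_distrib_left[symmetric] algebra_simps)
  finally show "N x \<le> ?C * norm x" .
qed

lemma continuous_on_vector_norm:
  fixes N :: "real ^ 'd \<Rightarrow> real"
  assumes "vector_norm N"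
  shows "continuous_on S N"
proof -
  obtain C where C: "C > 0" "\<And>x. N x \<le> C * norm x"
    using vector_norm_le_norm[OF assms] by blast
  have "C-lipschitz_on S N"
  proof (rule lipschitz_onI)
    fix x y
    have "N x \<le> N (x - y) + N y" "N y \<le> N (x - y) + N x"
      using vector_normD(4)[OF assms, of "x - y" y] vector_normD(4)[OF assms, of "y - x" x]
      by (simp_all add: vector_norm_minus_commute[OF assms, of y x])
    then show "dist (N x) (N y) \<le> C * dist x y"
      using C(2)[of "x - y"] by (simp add: dist_norm abs_le_iff)
  qed (use C in simp)
  then show ?thesis
    by (rule lipschitz_on_continuous_on)
qed

text \<open>The minimum of the continuous function \<open>N\<close> on the compact Euclidean unit sphere is positive.
  This is the direction of norm equivalence that bounds \<^term>\<open>unit_sphere N\<close>, and so the one that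
  makes the suprema in \<^const>\<open>dual_norm\<close> and \<^const>\<open>matrix_norm\<close> suprema of bounded sets.\<close>

lemma norm_le_vector_norm:
  fixes N :: "real ^ 'd \<Rightarrow> real"
  assumes "vector_norm N"
  obtains m where "m > 0" and "\<And>x. m * norm x \<le> N x"
proof -
  obtain z :: "real ^ 'd" where z: "norm z = 1" and min: "\<And>x. norm x = 1 \<Longrightarrow> N z \<le> N x"
    using continuous_attains_inf[OF compact_sphere _ continuous_on_vector_norm[OF assms], of 0 1]
    by (auto simp: sphere_eq_empty)
  show thesis
  proof
    show "N z > 0"
      using vector_normD(1,2)[OF assms, of z] z by force
    fix x
    show "N z * norm x \<le> N x"
    proof (cases "x = 0")
      case False
      then show ?thesis
        using min[of "x /\<^sub>R norm x"] by (simp add: vector_normD(3)[OF assms] field_simps)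
    qed (simp add: vector_normD(5)[OF assms])
  qed
qed

lemma bounded_unit_sphere:
  assumes "vector_norm N"
  shows "bounded (unit_sphere N)"
proof -
  obtain m where m: "m > 0" "\<And>x. m * norm x \<le> N x"
    using norm_le_vector_norm[OF assms] by blast
  have "norm x \<le> 1 / m" if "x \<in> unit_sphere N" for x
    using m(1) m(2)[of x] that by (simp add: unit_sphere_def field_simps)
  then show ?thesis
    by (auto simp: bounded_iff)
qed

lemma dual_norm_bound:
  fixes N :: "real ^ 'd \<Rightarrow> real"
  assumes "vector_norm N"
  shows "c \<bullet> x \<le> dual_norm N c * N x"
proof (cases "x = 0")
  case False
  have "bounded ((\<lambda>x. c \<bullet> x) ` unit_sphere N)"
    by (intro bounded_linear_image bounded_unit_sphere[OF assms] bounded_linear_inner_right)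
  then have "c \<bullet> (x /\<^sub>R N x) \<le> dual_norm N c"
    unfolding dual_norm_def
    using vector_norm_normalize[OF assms False]
    by (intro cSUP_upper) (auto simp: unit_sphere_def bounded_imp_bdd_above)
  moreover have "N x > 0"
    using False vector_normD(1,2)[OF assms, of x] by force
  ultimately show ?thesis
    by (simp add: field_simps)
qed (simp add: vector_normD(5)[OF assms])

lemma matrix_norm_upper:
  fixes N :: "real ^ 'd \<Rightarrow> real"
  assumes "vector_norm N" and "N x = 1"
  shows "N (A *v x) \<le> matrix_norm N A"
proof -
  obtain C where C: "C > 0" "\<And>x. N x \<le> C * norm x"
    using vector_norm_le_norm[OF assms(1)] by blast
  have "bounded ((\<lambda>x. A *v x) ` unit_sphere N)"
    by (intro bounded_linear_image bounded_unit_sphere[OF assms(1)] matrix_vector_mul_bounded_linear)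
  then obtain B where B: "\<And>x. x \<in> unit_sphere N \<Longrightarrow> norm (A *v x) \<le> B"
    by (auto simp: bounded_iff)
  have "N (A *v x) \<le> C * B" if "x \<in> unit_sphere N" for x
    using C(2)[of "A *v x"] B[OF that] C(1) by (meson mult_left_mono order_trans less_imp_le)
  then have "bdd_above ((\<lambda>x. N (A *v x)) ` unit_sphere N)"
    by (rule bdd_aboveI2)
  then show ?thesis
    unfolding matrix_norm_def using assms(2) by (intro cSUP_upper) (auto simp: unit_sphere_def)
qed

lemma matrix_norm_nonneg:
  fixes N :: "real ^ 'd \<Rightarrow> real"
  assumes "vector_norm N"
  shows "0 \<le> matrix_norm N A"
proof -
  have "axis undefined 1 \<noteq> (0 :: real ^ 'd)"
    by (simp add: axis_eq_0_iff)
  from matrix_norm_upper[OF assms vector_norm_normalize[OF assms this]]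
  show ?thesis
    using vector_normD(1)[OF assms] order_trans by blast
qed

lemma matrix_norm_bound:
  fixes N :: "real ^ 'd \<Rightarrow> real"
  assumes "vector_norm N"
  shows "N (A *v x) \<le> matrix_norm N A * N x"
proof (cases "x = 0")
  case False
  then have "N x > 0"
    using vector_normD(1,2)[OF assms, of x] by force
  with matrix_norm_upper[OF assms vector_norm_normalize[OF assms False], of A] show ?thesis
    by (simp add: matrix_vector_mult_scaleR vector_normD(3)[OF assms] field_simps)
qed (simp add: vector_normD(5)[OF assms])


section \<open>Packing numbers\<close>

text \<open>The maximum in \<^const>\<open>pack\<close> is only meaningful once separated sets are known to have bounded
  size: cover the bounded set by finitely many Euclidean balls so small that each of them contains
  at most one point of a separated set.\<close>

lemma card_le_pack:
  fixes N :: "real ^ 'd \<Rightarrow> real"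
  assumes "vector_norm N" and "bounded S" and "s > 0"
    and "P \<subseteq> S" and "finite P" and "\<And>x y. x \<in> P \<Longrightarrow> y \<in> P \<Longrightarrow> x \<noteq> y \<Longrightarrow> s \<le> N (x - y)"
  shows "card P \<le> pack N s S"
proof -
  let ?sep = "\<lambda>P. P \<subseteq> S \<and> finite P \<and> (\<forall>x\<in>P. \<forall>y\<in>P. x \<noteq> y \<longrightarrow> s \<le> N (x - y))"
  obtain C where C: "C > 0" "\<And>x. N x \<le> C * norm x"
    using vector_norm_le_norm[OF assms(1)] by blast
  let ?e = "s / (2 * C)"
  have "?e > 0"
    using C(1) assms(3) by simp
  moreover have "compact (closure S)"
    using assms(2) by simp
  ultimately obtain K where K: "finite K" "closure S \<subseteq> (\<Union>z\<in>K. ball z ?e)"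
    unfolding compact_eq_totally_bounded by blast
  have "card P \<le> card K" if P: "?sep P" for P
  proof -
    have "\<exists>z\<in>K. x \<in> ball z ?e" if "x \<in> P" for x
      using that P K(2) closure_subset[of S] by blast
    then obtain f where f: "\<And>x. x \<in> P \<Longrightarrow> f x \<in> K \<and> x \<in> ball (f x) ?e"
      by metis
    have "inj_on f P"
    proof (rule inj_onI, rule ccontr)
      fix x y
      assume xy: "x \<in> P" "y \<in> P" "f x = f y" "x \<noteq> y"
      then have "dist x (f x) < ?e" "dist y (f x) < ?e"
        using f by (metis dist_commute mem_ball)+
      then have "dist x y < ?e + ?e"
        using dist_triangle2[of x y "f x"] by linarith
      then have "C * norm (x - y) < s"
        using C(1) by (simp add: dist_norm field_simps)
      then show False
        using P xy C(2)[of "x - y"] by force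
    qed
    then show ?thesis
      using f K(1) by (intro card_inj_on_le[of f]) auto
  qed
  then have "finite {card P | P. ?sep P}"
    by (intro finite_subset[OF _ finite_atMost[of "card K"]]) blast
  then show ?thesis
    unfolding pack_def using assms by (intro Max_ge) blast+
qed


section \<open>New counterexamples are far from old samples\<close>

text \<open>If the candidate is nonpositive at \<open>y\<close>, then the linear form \<open>c x\<close> of the sample \<open>x\<close> drops by at
  least \<open>1 / \<epsilon>\<close> from \<open>x\<close> to \<open>y\<close>, and it is a contraction. Otherwise some active piece \<open>b\<close> does not
  decrease along \<open>A\<close> at \<open>y\<close>, although it satisfies the learner's inequality for \<open>A\<close> at \<open>x\<close>. The
  gap \<open>c x \<bullet> x - b \<bullet> x\<close> in that inequality is at most \<open>2 * N (x - y)\<close>, because \<open>b\<close> dominates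
  \<open>c x\<close> at \<open>y\<close>, and moving from \<open>x\<close> to \<open>y\<close> changes the derivative of \<open>b\<close> along \<open>A\<close> by at most
  \<open>a * N (x - y)\<close>; together they must make up for the margin \<open>\<delta>\<close>.\<close>

lemma counterexample_far_from_samples:
  fixes N :: "real ^ 'd \<Rightarrow> real"
  assumes N: "vector_norm N" and "\<theta> > 0" and learner: "learner_solution N F \<epsilon> \<theta> \<delta> X \<V>"
    and x: "x \<in> X" "N x = 1" "A *v x \<in> F x"
    and violation: "poly_fun \<V> y \<le> 0 \<or> (\<exists>c\<in>active_pieces \<V> y. 0 \<le> c \<bullet> (A *v y))"
    and a: "matrix_norm N A \<le> a" "0 \<le> a"
  shows "min (1 / \<epsilon>) (\<theta> * \<delta> / (2 + \<theta> * a)) \<le> N (x - y)"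
proof -
  obtain c where \<V>: "\<V> = c ` X" "\<V> \<subseteq> {b. dual_norm N b \<le> 1}"
    and "\<forall>x\<in>X. 1 / \<epsilon> * N x \<le> c x \<bullet> x \<and>
      (\<forall>v\<in>F x. \<forall>b\<in>\<V>. b \<bullet> v \<le> 1 / \<theta> * (c x \<bullet> x - b \<bullet> x) - \<delta> * N x)"
    using learner unfolding learner_solution_def by (elim exE conjE)
  note conditions = bspec[OF this(3) x(1)]
  have dual: "dual_norm N b \<le> 1" if "b \<in> \<V>" for b
    using \<V>(2) that by auto
  have positive: "1 / \<epsilon> * N x \<le> c x \<bullet> x"
    using conditions by (rule conjunct1)
  have decrease: "b \<bullet> (A *v x) \<le> 1 / \<theta> * (c x \<bullet> x - b \<bullet> x) - \<delta> * N x" if "b \<in> \<V>" for b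
    using conditions that x(3) by simp
  have cx: "c x \<in> \<V>"
    using \<V>(1) x(1) by simp
  have contract: "b \<bullet> v \<le> N v" if "b \<in> \<V>" for b v
    using dual_norm_bound[OF N, of b v] mult_right_mono[OF dual[OF that] vector_normD(1)[OF N, of v]]
    by simp
  from violation show ?thesis
  proof
    assume "poly_fun \<V> y \<le> 0"
    then have "c x \<bullet> y \<le> 0"
      using cx unfolding poly_fun_def by (simp add: SUP_le_iff)
    then have "1 / \<epsilon> \<le> c x \<bullet> (x - y)"
      using positive x(2) by (simp add: inner_diff_right)
    then show ?thesis
      using contract[OF cx, of "x - y"] by linarith
  next
    assume "\<exists>b\<in>active_pieces \<V> y. 0 \<le> b \<bullet> (A *v y)"
    then obtain b where b: "b \<in> \<V>" and active: "ereal (b \<bullet> y) = poly_fun \<V> y"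
      and nondecreasing: "0 \<le> b \<bullet> (A *v y)"
      unfolding active_pieces_def by blast
    have "ereal (c x \<bullet> y) \<le> poly_fun \<V> y"
      unfolding poly_fun_def using cx by (rule SUP_upper)
    then have "c x \<bullet> y \<le> b \<bullet> y"
      using active[symmetric] by simp
    then have gap: "c x \<bullet> x - b \<bullet> x \<le> 2 * N (x - y)"
      using contract[OF cx, of "x - y"] contract[OF b, of "y - x"]
      by (simp add: inner_diff_right vector_norm_minus_commute[OF N, of y x])
    have "b \<bullet> (A *v y) - b \<bullet> (A *v x) \<le> N (A *v (y - x))"
      using contract[OF b, of "A *v (y - x)"] by (simp add: matrix_vector_mult_diff_distrib inner_diff_right)
    also have "\<dots> \<le> a * N (x - y)"
      using matrix_norm_bound[OF N, of A "y - x"] mult_right_mono[OF a(1) vector_normD(1)[OF N, of "x - y"]]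
      by (simp add: vector_norm_minus_commute[OF N, of y x])
    finally have "\<delta> - 1 / \<theta> * (c x \<bullet> x - b \<bullet> x) \<le> a * N (x - y)"
      using decrease[OF b] nondecreasing x(2) by simp
    then have "\<theta> * \<delta> \<le> (c x \<bullet> x - b \<bullet> x) + \<theta> * a * N (x - y)"
      using \<open>\<theta> > 0\<close> by (simp add: field_simps)
    then have "\<theta> * \<delta> \<le> (2 + \<theta> * a) * N (x - y)"
      using gap by (simp add: algebra_simps)
    moreover have "2 + \<theta> * a > 0"
      using \<open>\<theta> > 0\<close> a(2) by (simp add: add_pos_nonneg)
    ultimately have "\<theta> * \<delta> / (2 + \<theta> * a) \<le> N (x - y)"
      by (simp add: field_simps)
    then show ?thesis
      by simp
  qed
qed

text \<open>Being a counterexample is invariant under positive scaling, since the regions are cones, the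
  pieces are linear and scaling does not change which of them are active. If the candidate is
  nonpositive, any mode active at the point will do; the regions cover the space.\<close>

lemma verifier_solution_normalize:
  fixes N :: "real ^ 'd \<Rightarrow> real"
  assumes N: "vector_norm N" and sys: "pwl_system Q H"
    and verifier: "verifier_solution (pwl_map Q H A) \<V> x"
  obtains q where "q \<in> Q" and "x /\<^sub>R N x \<in> H q"
    and "poly_fun \<V> (x /\<^sub>R N x) \<le> 0 \<or>
      (\<exists>c\<in>active_pieces \<V> (x /\<^sub>R N x). 0 \<le> c \<bullet> (A q *v (x /\<^sub>R N x)))"
proof -
  have "x \<noteq> 0"
    using verifier by (simp add: verifier_solution_def)
  then have pos: "inverse (N x) > 0"
    using vector_normD(1,2)[OF N, of x] by force
  have H: "x /\<^sub>R N x \<in> H q" if "q \<in> Q" "x \<in> H q" for q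
    using that sys pos by (auto simp: pwl_system_def conic_def)
  have le_scaled: "ereal (b \<bullet> (x /\<^sub>R N x)) \<le> ereal (c \<bullet> (x /\<^sub>R N x)) \<longleftrightarrow> b \<bullet> x \<le> c \<bullet> x" for b c
    using pos by simp
  from verifier consider "poly_fun \<V> x \<le> 0"
    | q c where "q \<in> Q" "x \<in> H q" "c \<in> active_pieces \<V> x" "0 \<le> c \<bullet> (A q *v x)"
    unfolding verifier_solution_def pwl_map_def by blast
  then show thesis
  proof cases
    case 1
    obtain q where "q \<in> Q" "x \<in> H q"
      using sys unfolding pwl_system_def by blast
    moreover have "poly_fun \<V> (x /\<^sub>R N x) \<le> 0"
      using 1 pos by (auto simp: poly_fun_def SUP_le_iff mult_nonneg_nonpos)
    ultimately show thesis
      using that H by blast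
  next
    case (2 q c)
    have "b \<bullet> x \<le> c \<bullet> x" if "b \<in> \<V>" for b
    proof -
      have "ereal (b \<bullet> x) \<le> poly_fun \<V> x"
        unfolding poly_fun_def using that by (rule SUP_upper)
      then have "ereal (b \<bullet> x) \<le> ereal (c \<bullet> x)"
        using 2(3) unfolding active_pieces_def by simp
      then show ?thesis
        by simp
    qed
    moreover have "c \<in> \<V>"
      using 2(3) by (simp add: active_pieces_def)
    ultimately have "poly_fun \<V> (x /\<^sub>R N x) = ereal (c \<bullet> (x /\<^sub>R N x))"
      unfolding poly_fun_def
      by (intro antisym SUP_least SUP_upper) (use le_scaled in blast)+
    then have "c \<in> active_pieces \<V> (x /\<^sub>R N x)"
      using \<open>c \<in> \<V>\<close> by (simp add: active_pieces_def)
    moreover have "0 \<le> c \<bullet> (A q *v (x /\<^sub>R N x))"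
      using 2(4) pos by (simp add: matrix_vector_mult_scaleR)
    ultimately show thesis
      using that 2(1,2) H by blast
  qed
qed


section \<open>Counting samples\<close>

text \<open>Here \<open>p\<close> chooses, among the modes active at a sample, the one to which the sample is charged.\<close>

definition charged_samples ::
  "(real ^ 'd \<Rightarrow> real) \<Rightarrow> 'q set \<Rightarrow> ('q \<Rightarrow> (real ^ 'd) set) \<Rightarrow> real \<Rightarrow> (real ^ 'd \<Rightarrow> 'q) \<Rightarrow>
   (real ^ 'd) set \<Rightarrow> bool" where
  "charged_samples N Q H r p X \<longleftrightarrow>
     finite X \<and> (\<forall>x\<in>X. N x = 1 \<and> p x \<in> Q \<and> x \<in> H (p x)) \<and>
     (\<forall>x\<in>X. \<forall>y\<in>X. x \<noteq> y \<and> p x = p y \<longrightarrow> r \<le> N (x - y))"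

lemma card_charged_samples_le:
  fixes N :: "real ^ 'd \<Rightarrow> real"
  assumes "vector_norm N" and "finite Q" and "r > 0" and X: "charged_samples N Q H r p X"
  shows "card X \<le> card Q * pack N r (unit_sphere N)"
proof -
  have "X = (\<Union>q\<in>Q. {x \<in> X. p x = q})"
    using X by (auto simp: charged_samples_def)
  then have "card X \<le> (\<Sum>q\<in>Q. card {x \<in> X. p x = q})"
    using card_UN_le[OF assms(2), of "\<lambda>q. {x \<in> X. p x = q}"] by simp
  also have "\<dots> \<le> (\<Sum>q\<in>Q. pack N r (unit_sphere N))"
    using X assms(1,3)
    by (intro sum_mono card_le_pack bounded_unit_sphere)
      (auto simp: charged_samples_def unit_sphere_def)
  finally show ?thesis
    by simp
qed

text \<open>A new counterexample is charged to the mode through which it was found. Its distance is bounded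
  below not only to the samples charged to this mode but to all samples in the region of this mode;
  that excludes that it is an old sample charged to another mode, and so the cardinality grows.\<close>

lemma charged_samples_step:
  fixes N :: "real ^ 'd \<Rightarrow> real"
  assumes N: "vector_norm N" and sys: "pwl_system Q H" and "\<theta> > 0" and "r > 0"
    and r: "r = min (1 / \<epsilon>) (\<theta> * \<delta> / (2 + \<theta> * a))"
    and a: "\<forall>q\<in>Q. matrix_norm N (A q) \<le> a" "0 \<le> a"
    and X: "charged_samples N Q H r p X"
    and learner: "learner_solution N (pwl_map Q H A) \<epsilon> \<theta> \<delta> X \<V>"
    and verifier: "verifier_solution (pwl_map Q H A) \<V> x"
  obtains p' where "charged_samples N Q H r p' (X \<union> {x /\<^sub>R N x})" and "x /\<^sub>R N x \<notin> X"
proof -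
  define y where "y = x /\<^sub>R N x"
  obtain q where q: "q \<in> Q" "y \<in> H q"
    and violation: "poly_fun \<V> y \<le> 0 \<or> (\<exists>c\<in>active_pieces \<V> y. 0 \<le> c \<bullet> (A q *v y))"
    using verifier_solution_normalize[OF N sys verifier] unfolding y_def by blast
  have Ny: "N y = 1"
    using verifier vector_norm_normalize[OF N] by (simp add: verifier_solution_def y_def)
  have far: "r \<le> N (z - y)" if "z \<in> X" "z \<in> H q" for z
    unfolding r
  proof (rule counterexample_far_from_samples[OF N \<open>\<theta> > 0\<close> learner that(1) _ _ violation])
    show "N z = 1"
      using X that by (simp add: charged_samples_def)
    show "A q *v z \<in> pwl_map Q H A z"
      using q(1) that(2) by (auto simp: pwl_map_def)
  qed (use a q in auto)
  have new: "y \<notin> X"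
    using far[of y] q(2) \<open>r > 0\<close> vector_normD(5)[OF N] by auto
  have far': "r \<le> N (y - z)" if "z \<in> X" "z \<in> H q" for z
    using far[OF that] vector_norm_minus_commute[OF N] by metis
  have "charged_samples N Q H r (p(y := q)) (X \<union> {y})"
    using X new q Ny far far' unfolding charged_samples_def by auto
  with new show thesis
    using that unfolding y_def by blast
qed

lemma running_invariant:
  fixes N :: "real ^ 'd \<Rightarrow> real"
  assumes "vector_norm N" and "pwl_system Q H" and "\<theta> > 0" and "r > 0"
    and "r = min (1 / \<epsilon>) (\<theta> * \<delta> / (2 + \<theta> * a))"
    and "\<forall>q\<in>Q. matrix_norm N (A q) \<le> a" and "0 \<le> a"
    and exec: "execution N (pwl_map Q H A) \<epsilon> \<theta> \<delta> s"
  shows "s k = Running X \<Longrightarrow> card X = k \<and> (\<exists>p. charged_samples N Q H r p X)"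
proof (induction k arbitrary: X)
  case 0
  then show ?case
    using exec by (simp add: execution_def charged_samples_def)
next
  case (Suc k)
  have step: "case s k of Running X \<Rightarrow> iteration N (pwl_map Q H A) \<epsilon> \<theta> \<delta> X (s (Suc k))
      | _ \<Rightarrow> s (Suc k) = s k"
    using exec by (simp add: execution_def)
  with Suc.prems obtain X0 where X0: "s k = Running X0"
    and it: "iteration N (pwl_map Q H A) \<epsilon> \<theta> \<delta> X0 (Running X)"
    by (auto split: alg_state.splits)
  obtain p where p: "charged_samples N Q H r p X0" and card: "card X0 = k"
    using Suc.IH[OF X0] by blast
  from it obtain \<V> x where X: "X = X0 \<union> {x /\<^sub>R N x}"
    and "learner_solution N (pwl_map Q H A) \<epsilon> \<theta> \<delta> X0 \<V>" "verifier_solution (pwl_map Q H A) \<V> x"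
    by (auto elim: iteration.cases)
  then obtain p' where "charged_samples N Q H r p' X" "x /\<^sub>R N x \<notin> X0"
    using charged_samples_step[OF assms(1-7) p] by blast
  then show ?case
    using p card unfolding X charged_samples_def by auto
qed

theorem theorem26:
  fixes N :: "real ^ 'd \<Rightarrow> real"
    and Q :: "'q set"
    and H :: "'q \<Rightarrow> (real ^ 'd) set"
    and A :: "'q \<Rightarrow> real ^ 'd ^ 'd"
    and \<epsilon> \<theta> \<delta> r :: real
  assumes "vector_norm N"
    and "pwl_system Q H"
    and "\<epsilon> \<ge> 1" and "\<theta> > 0" and "\<delta> > 0"
    and "r = min (1 / \<epsilon>) (\<theta> * \<delta> / (2 + \<theta> * a_max N Q A))"
  shows "terminates_in_at_most (card Q * pack N r (unit_sphere N)) N (pwl_map Q H A) \<epsilon> \<theta> \<delta>"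
proof -
  let ?n = "card Q * pack N r (unit_sphere N)"
  have Q: "finite Q" "Q \<noteq> {}"
    using assms(2) by (auto simp: pwl_system_def)
  have a: "\<forall>q\<in>Q. matrix_norm N (A q) \<le> a_max N Q A"
    unfolding a_max_def using Q by (intro ballI Max_ge) auto
  have a0: "0 \<le> a_max N Q A"
    using Q(2) a matrix_norm_nonneg[OF assms(1)] order_trans by (metis ex_in_conv)
  have "r > 0"
    using assms(3-6) a0 by (simp add: add_pos_nonneg)
  have "\<exists>k\<le>?n. s (Suc k) = Fail \<or> (\<exists>\<V>. s (Suc k) = Output \<V>)"
    if exec: "execution N (pwl_map Q H A) \<epsilon> \<theta> \<delta> s" for s
  proof (rule exI[of _ ?n], cases "s (Suc ?n)")
    case (Running X)
    \<comment> \<open>State \<open>Suc ?n\<close> is reached after \<open>?n + 1\<close> iterations; if each of them had added a sample,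
      there would be one more than the bound allows.\<close>
    with running_invariant[OF assms(1,2,4) \<open>r > 0\<close> assms(6) a a0 exec, of "Suc ?n"]
    obtain p where "card X = Suc ?n" "charged_samples N Q H r p X"
      by blast
    with card_charged_samples_le[OF assms(1) Q(1) \<open>r > 0\<close>, of H p X]
    show "?n \<le> ?n \<and> (s (Suc ?n) = Fail \<or> (\<exists>\<V>. s (Suc ?n) = Output \<V>))"
      by linarith
  qed simp_all
  then show ?thesis
    unfolding terminates_in_at_most_def by blast
qed

end
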